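(* Assume that the events $E_1,E_2,E_3,H_1,H_2,H_3$ are logically independent and let $(x_1,x_2,x_3)\in[0,1]^3$ be such that $T_L(x_1,x_2)>0$, $T_L(x_1,x_3)>0$, $T_L(x_2,x_3)>0$. The assessment $(x_1,x_2,x_3,T_L(x_1,x_2),T_L(x_1,x_3),T_L(x_2,x_3))$ on the family $\mathcal F=\{\mathcal C_1,\mathcal C_2,\mathcal C_3,\mathcal C_{12},\mathcal C_{13},\mathcal C_{23}\}$ is coherent if and only if $x_1+x_2+x_3-2\ge 0$. Moreover, when $x_1+x_2+x_3-2\geq 0$, the unique coherent extension $x_{123}$ on $\mathcal C_{123}$ (i.e. the unique real $x_{123}$ such that $(x_1,x_2,x_3,T_L(x_1,x_2),T_L(x_1,x_3),T_L(x_2,x_3),x_{123})$ is coherent on $\mathcal F\cup\{\mathcal C_{123}\}$) is $x_{123}=T_L(x_1,x_2,x_3)$.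
   Context: **Lukasiewicz t-norm.** $T_L(u,v)=\max\{u+v-1,0\}$ for $u,v\in[0,1]$, and $T_L(x_1,x_2,x_3)=T_L(T_L(x_1,x_2),x_3)=\max\{x_1+x_2+x_3-2,0\}$. **Events.** Events are subsets of a set $\Omega$ of elementary outcomes; $\overline{E}$ is the complement of $E$, juxtaposition $EF$ denotes intersection, $\vee$ denotes union. Events $F_1,\dots,F_n$ are logically independent if all $2^n$ intersections $F_1^*\cdots F_n^*$, with $F_i^*\in\{F_i,\overline{F}_i\}$, are nonempty. **Conjunctions.** Given conditional events $E_1|H_1,E_2|H_2,E_3|H_3$ and a real number $x_S$ for each nonempty $S\subseteq\{1,2,3\}$ (written $x_i,x_{ij},x_{123}$, with $x_{ij}=x_{ji}$), where $x_S$ is the prevision assessed on $\bigwedge_{i\in S}(E_i|H_i)$, the conjunction $\mathcal C_S=\bigwedge_{i\in S}(E_i|H_i)$ (written $\mathcal C_i,\mathcal C_{ij},\mathcal C_{123}$) is the random quantity equal to: $1$ on $\bigwedge_{i\in S}E_iH_i$; $0$ on $\bigvee_{i\in S}\overline{E}_iH_i$; and $x_{S'}$ on $\bigwedge_{i\in S'}\overline{H}_i\wedge\bigwedge_{i\in S\setminus S'}E_iH_i$, for each $\emptyset\neq S'\subseteq S$. In particular $\mathcal C_i=E_i|H_i$ equals $1$ on $E_iH_i$, $0$ on $\overline{E}_iH_i$, $x_i$ on $\overline{H}_i$. $\mathcal C_S$ is a conditional random quantity with conditioning event $\bigvee_{i\in S}H_i$ and prevision $x_S$. **Coherence.** Let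 $\mathcal F=\{X_1|K_1,\dots,X_n|K_n\}$ be a finite family of conditional random quantities, where $X_i$ takes finitely many real values when the conditioning event $K_i\ne\emptyset$ is true, and let $\mathcal M=(\mu_1,\dots,\mu_n)\in\mathbb R^n$ be a (prevision) assessment, $\mu_i=\mathbb P(X_i|K_i)$. Let $C_1,\dots,C_m$ be the constituents contained in $K_1\vee\cdots\vee K_n$, i.e. the nonempty atoms of the finite partition generated by the events $K_i$ and the events $(X_i=\text{value})\cap K_i$. To $C_h$ associate $Q_h=(q_{h1},\dots,q_{hn})$, where $q_{hi}$ is the value of $X_i$ on $C_h$ if $C_h\subseteq K_i$, and $q_{hi}=\mu_i$ if $C_h\subseteq\overline{K}_i$. Let $S$ be the set of vectors $(\lambda_1,\dots,\lambda_m)$ with $\lambda_h\ge 0$, $\sum_h\lambda_h=1$, $\sum_h\lambda_hQ_h=\mathcal M$, and, when $S\neq\emptyset$, let $I_0=\{i:\max_{\Lambda\in S}\sum_{h:C_h\subseteq K_i}\lambda_h=0\}$. Then $\mathcal M$ is coherent on $\mathcal F$ if and only if (i) $S\neq\emptyset$, and (ii) if $I_0\ne\emptyset$, then the sub-assessment $(\mu_i,\ i\in I_0)$ on $\{X_i|K_i,\ i\in I_0\}$ is coherent (the recursion terminates because $I_0$ is a proper subset of $\{1,\dots,n\}$). *)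

theory Defs
  imports "HOL-Analysis.Analysis"
begin

definition T_L :: "real \<Rightarrow> real \<Rightarrow> real" where
  "T_L u v = max (u + v - 1) 0"

definition T_L3 :: "real \<Rightarrow> real \<Rightarrow> real \<Rightarrow> real" where
  "T_L3 u v w = T_L (T_L u v) w"

definition logically_independent :: "'w set list \<Rightarrow> bool" where
  "logically_independent Fs \<longleftrightarrow>
     (\<forall>J \<subseteq> {..<length Fs}. (\<Inter>i<length Fs. if i \<in> J then Fs ! i else - (Fs ! i)) \<noteq> {})"


(* A family of conditional random quantities X_i|K_i, i in I, is given by the index set I and the
   maps X and K; X i matters only on K i.  The notions below are meant for finite nonempty I,
   nonempty K i and finite X i ` K i. *)

definition generating_events :: "'i set \<Rightarrow> ('i \<Rightarrow> 'w \<Rightarrow> real) \<Rightarrow> ('i \<Rightarrow> 'w set) \<Rightarrow> 'w set set" where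
  "generating_events I X K =
     K ` I \<union> {{w \<in> K i. X i w = v} | i v. i \<in> I \<and> v \<in> X i ` K i}"

definition atoms_of :: "'w set set \<Rightarrow> 'w set set" where
  "atoms_of G = {\<Inter>P \<inter> (\<Inter>B\<in>G - P. - B) | P. P \<subseteq> G} - {{}}"

definition constituents :: "'i set \<Rightarrow> ('i \<Rightarrow> 'w \<Rightarrow> real) \<Rightarrow> ('i \<Rightarrow> 'w set) \<Rightarrow> 'w set set" where
  "constituents I X K = {C \<in> atoms_of (generating_events I X K). C \<subseteq> (\<Union>i\<in>I. K i)}"

(* X i is constant on a constituent C contained in K i, so X i ` C is then a singleton. *)
definition Q_point ::
  "('i \<Rightarrow> 'w \<Rightarrow> real) \<Rightarrow> ('i \<Rightarrow> 'w set) \<Rightarrow> ('i \<Rightarrow> real) \<Rightarrow> 'w set \<Rightarrow> 'i \<Rightarrow> real" where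
  "Q_point X K \<mu> C i = (if C \<subseteq> K i then the_elem (X i ` C) else \<mu> i)"

definition solutions ::
  "'i set \<Rightarrow> ('i \<Rightarrow> 'w \<Rightarrow> real) \<Rightarrow> ('i \<Rightarrow> 'w set) \<Rightarrow> ('i \<Rightarrow> real) \<Rightarrow> ('w set \<Rightarrow> real) set" where
  "solutions I X K \<mu> =
     {\<Lambda> \<in> constituents I X K \<rightarrow>\<^sub>E {0..}.
        (\<Sum>C\<in>constituents I X K. \<Lambda> C) = 1 \<and>
        (\<forall>i\<in>I. (\<Sum>C\<in>constituents I X K. \<Lambda> C * Q_point X K \<mu> C i) = \<mu> i)}"

(* The solution set is a compact polytope, so the supremum is a maximum whenever that set is
   nonempty; for an empty solution set the value of I_0 is never used. *)
definition I_0 ::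
  "'i set \<Rightarrow> ('i \<Rightarrow> 'w \<Rightarrow> real) \<Rightarrow> ('i \<Rightarrow> 'w set) \<Rightarrow> ('i \<Rightarrow> real) \<Rightarrow> 'i set" where
  "I_0 I X K \<mu> =
     {i \<in> I. (SUP \<Lambda>\<in>solutions I X K \<mu>. \<Sum>C | C \<in> constituents I X K \<and> C \<subseteq> K i. \<Lambda> C) = 0}"

(* The recursive characterisation of coherence, as a least fixed point: the equivalence is
   coherent.simps, and the recursion is well-founded for finite I by I_0_psubset below. *)
inductive coherent ::
  "('i \<Rightarrow> 'w \<Rightarrow> real) \<Rightarrow> ('i \<Rightarrow> 'w set) \<Rightarrow> ('i \<Rightarrow> real) \<Rightarrow> 'i set \<Rightarrow> bool"
  for X K \<mu> where
  "\<lbrakk> solutions I X K \<mu> \<noteq> {};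
     I_0 I X K \<mu> \<noteq> {} \<longrightarrow> coherent X K \<mu> (I_0 I X K \<mu>) \<rbrakk>
   \<Longrightarrow> coherent X K \<mu> I"

lemma constituent_subset_or_disjoint:
  assumes "C \<in> constituents I X K" "i \<in> I"
  shows "C \<subseteq> K i \<or> C \<subseteq> - K i"
proof -
  obtain P where C: "C = \<Inter>P \<inter> (\<Inter>B\<in>generating_events I X K - P. - B)"
    using assms(1) unfolding constituents_def atoms_of_def by auto
  have "K i \<in> generating_events I X K"
    using assms(2) unfolding generating_events_def by auto
  then show ?thesis unfolding C by (cases "K i \<in> P") auto
qed

lemma I_0_psubset:
  assumes "solutions I X K \<mu> \<noteq> {}"
  shows "I_0 I X K \<mu> \<subset> I"
proof -
  let ?Cs = "constituents I X K"
  let ?f = "\<lambda>i \<Lambda>. \<Sum>C | C \<in> ?Cs \<and> C \<subseteq> K i. \<Lambda> C"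
  obtain \<Lambda> where \<Lambda>: "\<Lambda> \<in> solutions I X K \<mu>" using assms by auto
  have one: "sum \<Lambda>' ?Cs = 1" and pos: "\<And>C. C \<in> ?Cs \<Longrightarrow> \<Lambda>' C \<ge> 0"
    if "\<Lambda>' \<in> solutions I X K \<mu>" for \<Lambda>'
    using that unfolding solutions_def by (auto simp: PiE_iff)
  have fin: "finite ?Cs"
    using one[OF \<Lambda>] by (metis sum.infinite zero_neq_one)
  have le1: "?f i \<Lambda>' \<le> 1" if "\<Lambda>' \<in> solutions I X K \<mu>" for i \<Lambda>'
    using sum_mono2[of ?Cs "{C \<in> ?Cs. C \<subseteq> K i}" \<Lambda>'] fin one[OF that] pos[OF that] by auto
  obtain C where C: "C \<in> ?Cs" "\<Lambda> C \<noteq> 0"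
    using one[OF \<Lambda>] by (metis sum.neutral zero_neq_one)
  have "C \<noteq> {}" "C \<subseteq> (\<Union>i\<in>I. K i)"
    using C(1) unfolding constituents_def atoms_of_def by auto
  then obtain w i where i: "i \<in> I" "w \<in> C" "w \<in> K i" by blast
  then have "C \<subseteq> K i" using constituent_subset_or_disjoint[OF C(1) i(1)] by blast
  then have "\<Lambda> C \<le> ?f i \<Lambda>"
    using C fin pos[OF \<Lambda>] by (intro member_le_sum) auto
  then have "0 < ?f i \<Lambda>" using C pos[OF \<Lambda>, of C] by auto
  also have "?f i \<Lambda> \<le> (SUP \<Lambda>\<in>solutions I X K \<mu>. ?f i \<Lambda>)"
    by (rule cSUP_upper[OF \<Lambda>]) (auto intro!: bdd_aboveI[of _ 1] le1)
  finally have "i \<notin> I_0 I X K \<mu>" unfolding I_0_def by auto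
  then show ?thesis using i(1) unfolding I_0_def by blast
qed


(* The assessment x is indexed by the nonempty index sets S themselves: x {i}, x {i, j}, ...
   In the last case of conjunction, the set {i \<in> S. w \<notin> H i} is the unique S' in question. *)
definition conjunction ::
  "(nat \<Rightarrow> 'w set) \<Rightarrow> (nat \<Rightarrow> 'w set) \<Rightarrow> (nat set \<Rightarrow> real) \<Rightarrow> nat set \<Rightarrow> 'w \<Rightarrow> real" where
  "conjunction E H x S w =
     (if w \<in> (\<Inter>i\<in>S. E i \<inter> H i) then 1
      else if w \<in> (\<Union>i\<in>S. - E i \<inter> H i) then 0
      else x {i \<in> S. w \<notin> H i})"

definition conditioning_event :: "(nat \<Rightarrow> 'w set) \<Rightarrow> nat set \<Rightarrow> 'w set" where
  "conditioning_event H S = (\<Union>i\<in>S. H i)"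

definition coherent_conjunctions ::
  "(nat \<Rightarrow> 'w set) \<Rightarrow> (nat \<Rightarrow> 'w set) \<Rightarrow> (nat set \<Rightarrow> real) \<Rightarrow> nat set set \<Rightarrow> bool" where
  "coherent_conjunctions E H x \<F> \<longleftrightarrow>
     coherent (conjunction E H x) (conditioning_event H) x \<F>"

end

theory Submission
  imports Defs
begin

text \<open>
  Pointwise \<open>\<C>\<^sub>i\<^sub>j \<ge> \<C>\<^sub>i + \<C>\<^sub>j - 1\<close>, and the assessment makes this an equality on average; hence every
  solution of the system is supported on constituents where the three equalities hold. On such a
  constituent \<open>\<C>\<^sub>1\<^sub>2\<^sub>3 = \<C>\<^sub>1 + \<C>\<^sub>2 + \<C>\<^sub>3 - 2 \<ge> 0\<close>. Averaging gives the necessity of the inequality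
  and the uniqueness of the extension. Conversely, if \<open>x\<^sub>1 + x\<^sub>2 + x\<^sub>3 \<ge> 2\<close>, put weight \<open>1 - x\<^sub>k\<close> on
  the constituent where all \<open>H\<^sub>i\<close> hold and only \<open>E\<^sub>k\<close> fails, and the remaining weight on the one
  where everything holds.
\<close>

section \<open>Atoms, constituents and their representative points\<close>

text \<open>An atom is named here by one of its points instead of by a subset of \<open>G\<close>:
  it is the class of \<open>w\<close> under indistinguishability by the members of
  \<open>G\<close>.\<close>

definition atom_at :: "'w set set \<Rightarrow> 'w \<Rightarrow> 'w set" where
  "atom_at G w = {v. \<forall>B\<in>G. v \<in> B \<longleftrightarrow> w \<in> B}"

lemma atom_at_in_atoms_of: "atom_at G w \<in> atoms_of G"
proof -
  have "atom_at G w = \<Inter>{B \<in> G. w \<in> B} \<inter> (\<Inter>B\<in>G - {B \<in> G. w \<in> B}. - B)"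
    unfolding atom_at_def by auto
  moreover have "w \<in> atom_at G w"
    unfolding atom_at_def by simp
  ultimately show ?thesis
    unfolding atoms_of_def by blast
qed

lemma atoms_of_mem_iff:
  assumes "C \<in> atoms_of G" "v \<in> C" "w \<in> C" "B \<in> G"
  shows "v \<in> B \<longleftrightarrow> w \<in> B"
proof -
  obtain P where "C = \<Inter>P \<inter> (\<Inter>B\<in>G - P. - B)"
    using assms(1) unfolding atoms_of_def by auto
  then show ?thesis
    using assms(2-4) by (cases "B \<in> P") auto
qed

lemma atoms_of_subset: "atoms_of G \<subseteq> (\<lambda>P. \<Inter>P \<inter> (\<Inter>B\<in>G - P. - B)) ` Pow G"
  unfolding atoms_of_def by auto

lemma finite_constituents:
  assumes "finite I" "\<And>i. i \<in> I \<Longrightarrow> finite (X i ` K i)"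
  shows "finite (constituents I X K)"
proof -
  have "generating_events I X K = K ` I \<union> (\<Union>i\<in>I. (\<lambda>v. {w \<in> K i. X i w = v}) ` (X i ` K i))"
    unfolding generating_events_def by blast
  then have "finite (generating_events I X K)"
    using assms by simp
  then have "finite (atoms_of (generating_events I X K))"
    by (meson atoms_of_subset finite_Pow_iff finite_imageI finite_subset)
  then show ?thesis
    unfolding constituents_def by simp
qed

text \<open>The level set of \<open>X i\<close> through \<open>w\<close> is a generating event, so
  \<open>X i\<close> is constant on \<open>C\<close>. Hence \<open>the_elem\<close> can be replaced
  by evaluation at any point of \<open>C\<close>.\<close>

lemma Q_point_eq:
  assumes C: "C \<in> constituents I X K" and "i \<in> I" "w \<in> C"
  shows "Q_point X K \<mu> C i = (if w \<in> K i then X i w else \<mu> i)"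
proof (cases "w \<in> K i")
  case True
  then have sub: "C \<subseteq> K i"
    using constituent_subset_or_disjoint[OF C \<open>i \<in> I\<close>] \<open>w \<in> C\<close> by blast
  have "{u \<in> K i. X i u = X i w} \<in> generating_events I X K"
    using \<open>i \<in> I\<close> True unfolding generating_events_def by blast
  moreover have "C \<in> atoms_of (generating_events I X K)"
    using C unfolding constituents_def by simp
  ultimately have "X i v = X i w" if "v \<in> C" for v
    using atoms_of_mem_iff[of C _ v w "{u \<in> K i. X i u = X i w}"] that \<open>w \<in> C\<close> True by simp
  then have "X i ` C = (\<lambda>_. X i w) ` C"
    by (rule image_cong[OF refl])
  also have "\<dots> = {X i w}"
    using \<open>w \<in> C\<close> by (rule image_constant)
  finally show ?thesis
    using sub True unfolding Q_point_def by simp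
next
  case False
  then show ?thesis
    using \<open>w \<in> C\<close> unfolding Q_point_def by auto
qed

section \<open>Coherence and finite probabilities on sample points\<close>

text \<open>A solution of the system becomes a finite probability on points once one point is chosen
  in each constituent; later arguments can then be made pointwise.\<close>

lemma coherent_imp_mixture:
  assumes "coherent X K \<mu> I"
  obtains A and p :: "'w set \<Rightarrow> real" and w :: "'w set \<Rightarrow> 'w"
  where "finite A" "\<And>C. C \<in> A \<Longrightarrow> p C \<ge> 0" "sum p A = 1"
    "\<And>C. C \<in> A \<Longrightarrow> w C \<in> (\<Union>i\<in>I. K i)"
    "\<And>i. i \<in> I \<Longrightarrow> (\<Sum>C\<in>A. p C * (if w C \<in> K i then X i (w C) else \<mu> i)) = \<mu> i"
proof -
  let ?Cs = "constituents I X K"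
  have "solutions I X K \<mu> \<noteq> {}"
    using assms by (auto elim: coherent.cases)
  then obtain \<Lambda> where \<Lambda>: "\<Lambda> \<in> ?Cs \<rightarrow>\<^sub>E {0..}" "sum \<Lambda> ?Cs = 1"
    "\<And>i. i \<in> I \<Longrightarrow> (\<Sum>C\<in>?Cs. \<Lambda> C * Q_point X K \<mu> C i) = \<mu> i"
    unfolding solutions_def by blast
  define w where "w C = (SOME v. v \<in> C)" for C :: "'w set"
  have w: "w C \<in> C" "C \<subseteq> (\<Union>i\<in>I. K i)" if "C \<in> ?Cs" for C
  proof -
    have "C \<noteq> {}" and sub: "C \<subseteq> (\<Union>i\<in>I. K i)"
      using that unfolding constituents_def atoms_of_def by auto
    then show "w C \<in> C"
      unfolding w_def by (simp add: some_in_eq)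
    show "C \<subseteq> (\<Union>i\<in>I. K i)" by (fact sub)
  qed
  show thesis
  proof
    show "finite ?Cs"
      using \<Lambda>(2) by (metis sum.infinite zero_neq_one)
    show "\<Lambda> C \<ge> 0" if "C \<in> ?Cs" for C
      using \<Lambda>(1) that by (auto simp: PiE_iff)
    show "w C \<in> (\<Union>i\<in>I. K i)" if "C \<in> ?Cs" for C
      using w[OF that] by blast
    show "(\<Sum>C\<in>?Cs. \<Lambda> C * (if w C \<in> K i then X i (w C) else \<mu> i)) = \<mu> i" if "i \<in> I" for i
    proof -
      have Q: "Q_point X K \<mu> C i = (if w C \<in> K i then X i (w C) else \<mu> i)" if "C \<in> ?Cs" for C
        using Q_point_eq[OF that \<open>i \<in> I\<close> w(1)[OF that]] .
      have "(\<Sum>C\<in>?Cs. \<Lambda> C * (if w C \<in> K i then X i (w C) else \<mu> i))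
          = (\<Sum>C\<in>?Cs. \<Lambda> C * Q_point X K \<mu> C i)"
        by (rule sum.cong[OF refl]) (simp only: Q)
      then show ?thesis
        using \<Lambda>(3)[OF that] by (rule trans)
    qed
  qed (fact \<Lambda>(2))
qed

text \<open>The masses of \<open>K i\<close> under solutions are bounded by 1, so their supremum
  dominates the positive mass given by \<open>\<Lambda>\<close>.\<close>

lemma I_0_empty:
  assumes \<Lambda>: "\<Lambda> \<in> solutions I X K \<mu>"
    and pos: "\<And>i. i \<in> I \<Longrightarrow> (\<Sum>C | C \<in> constituents I X K \<and> C \<subseteq> K i. \<Lambda> C) > 0"
  shows "I_0 I X K \<mu> = {}"
proof -
  let ?Cs = "constituents I X K"
  have "(\<Sum>C | C \<in> ?Cs \<and> C \<subseteq> K i. \<Lambda>' C) \<le> 1" if "\<Lambda>' \<in> solutions I X K \<mu>" for i \<Lambda>'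
  proof -
    have one: "sum \<Lambda>' ?Cs = 1" and ge: "\<And>C. C \<in> ?Cs \<Longrightarrow> \<Lambda>' C \<ge> 0"
      using that unfolding solutions_def by (auto simp: PiE_iff)
    have "finite ?Cs"
      using one by (metis sum.infinite zero_neq_one)
    then show ?thesis
      using sum_mono2[of ?Cs "{C \<in> ?Cs. C \<subseteq> K i}" \<Lambda>'] one ge by auto
  qed
  then have "(\<Sum>C | C \<in> ?Cs \<and> C \<subseteq> K i. \<Lambda> C)
      \<le> (SUP \<Lambda>\<in>solutions I X K \<mu>. \<Sum>C | C \<in> ?Cs \<and> C \<subseteq> K i. \<Lambda> C)" for i
    by (intro cSUP_upper[OF \<Lambda>] bdd_aboveI[of _ 1]) auto
  then show ?thesis
    using pos unfolding I_0_def by (fastforce dest: less_le_trans)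
qed

text \<open>All points \<open>w j\<close> lie in every \<open>K i\<close>, so the solution they
  induce gives each \<open>K i\<close> mass 1. Thus \<open>I_0\<close> is empty and the recursion
  stops at its first level.\<close>

lemma coherent_if_mixture:
  assumes "finite I" "I \<noteq> {}" and finX: "\<And>i. i \<in> I \<Longrightarrow> finite (X i ` K i)"
    and "finite J" and p: "\<And>j. j \<in> J \<Longrightarrow> p j \<ge> 0" "sum p J = 1"
    and w: "\<And>i j. i \<in> I \<Longrightarrow> j \<in> J \<Longrightarrow> w j \<in> K i"
    and eq: "\<And>i. i \<in> I \<Longrightarrow> (\<Sum>j\<in>J. p j * X i (w j)) = \<mu> i"
  shows "coherent X K \<mu> I"
proof -
  let ?Cs = "constituents I X K"
  define c where "c j = atom_at (generating_events I X K) (w j)" for j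
  have finC: "finite ?Cs"
    using finite_constituents[OF \<open>finite I\<close>] finX by blast
  have mem: "w j \<in> c j" for j
    unfolding c_def atom_at_def by simp
  have sub: "c j \<subseteq> K i" if "i \<in> I" "j \<in> J" for i j
  proof -
    have "K i \<in> generating_events I X K"
      using that unfolding generating_events_def by blast
    then show ?thesis
      using w[OF that] unfolding c_def atom_at_def by blast
  qed
  have c: "c j \<in> ?Cs" if "j \<in> J" for j
  proof -
    have "c j \<subseteq> (\<Union>i\<in>I. K i)"
      using \<open>I \<noteq> {}\<close> sub[OF _ that] by blast
    then show ?thesis
      unfolding constituents_def using atom_at_in_atoms_of by (simp add: c_def)
  qed
  \<comment> \<open>The image of \<open>p\<close> under \<open>c\<close>: several points may share a
    constituent, so weights are added over fibres.\<close>
  define \<Lambda> where "\<Lambda> = (\<lambda>C\<in>?Cs. \<Sum>j | j \<in> J \<and> c j = C. p j)"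
  \<comment> \<open>Used with \<open>T\<close> all constituents for the equations of the system, and
    with \<open>T\<close> those inside \<open>K i\<close> for the mass of
    \<open>K i\<close>.\<close>
  have \<Lambda>_sum: "(\<Sum>C\<in>T. \<Lambda> C * f C) = (\<Sum>j\<in>J. p j * f (c j))"
    if "T \<subseteq> ?Cs" "c ` J \<subseteq> T" for T and f :: "'b set \<Rightarrow> real"
  proof -
    have "(\<Sum>C\<in>T. \<Lambda> C * f C) = (\<Sum>C\<in>T. \<Sum>j | j \<in> J \<and> c j = C. p j * f (c j))"
      using that(1) by (intro sum.cong) (auto simp: \<Lambda>_def sum_distrib_right)
    also have "\<dots> = (\<Sum>j\<in>J. p j * f (c j))"
      by (rule sum.group[OF \<open>finite J\<close> finite_subset[OF that(1) finC] that(2)])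
    finally show ?thesis .
  qed
  have sol: "\<Lambda> \<in> solutions I X K \<mu>"
    unfolding solutions_def
  proof (intro CollectI conjI ballI)
    show "\<Lambda> \<in> ?Cs \<rightarrow>\<^sub>E {0..}"
      unfolding \<Lambda>_def using p(1) by (auto intro: sum_nonneg)
    show "sum \<Lambda> ?Cs = 1"
      using \<Lambda>_sum[of ?Cs "\<lambda>_. 1"] c p(2) by auto
    show "(\<Sum>C\<in>?Cs. \<Lambda> C * Q_point X K \<mu> C i) = \<mu> i" if "i \<in> I" for i
    proof -
      have "(\<Sum>C\<in>?Cs. \<Lambda> C * Q_point X K \<mu> C i) = (\<Sum>j\<in>J. p j * Q_point X K \<mu> (c j) i)"
        using c by (intro \<Lambda>_sum) auto
      also have "\<dots> = (\<Sum>j\<in>J. p j * X i (w j))"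
        using Q_point_eq[OF c that mem] w[OF that] by (intro sum.cong) auto
      finally show ?thesis
        using eq[OF that] by simp
    qed
  qed
  have "(\<Sum>C | C \<in> ?Cs \<and> C \<subseteq> K i. \<Lambda> C) = 1" if "i \<in> I" for i
    using \<Lambda>_sum[of "{C \<in> ?Cs. C \<subseteq> K i}" "\<lambda>_. 1"] c sub[OF that] p(2) by auto
  then have "I_0 I X K \<mu> = {}"
    by (intro I_0_empty[OF sol]) auto
  then show ?thesis
    using sol by (intro coherent.intros) auto
qed

section \<open>Pointwise relations between conjunctions\<close>

lemma conjunction_outside:
  assumes "w \<notin> conditioning_event H S" "S \<noteq> {}"
  shows "conjunction E H x S w = x S"
proof -
  have "{i \<in> S. w \<notin> H i} = S"
    using assms(1) unfolding conditioning_event_def by auto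
  moreover have "w \<notin> (\<Inter>i\<in>S. E i \<inter> H i)" "w \<notin> (\<Union>i\<in>S. - E i \<inter> H i)"
    using assms unfolding conditioning_event_def by auto
  ultimately show ?thesis
    unfolding conjunction_def by (simp only: if_False)
qed

lemma finite_conjunction_image:
  assumes "finite S"
  shows "finite (conjunction E H x S ` W)"
proof (rule finite_subset)
  show "conjunction E H x S ` W \<subseteq> insert 1 (insert 0 (x ` Pow S))"
    unfolding conjunction_def by auto
  show "finite (insert 1 (insert 0 (x ` Pow S)))"
    using assms by simp
qed

text \<open>Evaluates the index set in the last case of \<open>conjunction\<close> element by
  element for explicit \<open>S\<close>.\<close>

lemma Collect_mem_insert:
  "{k \<in> insert i S. P k} = (if P i then insert i {k \<in> S. P k} else {k \<in> S. P k})"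
  by auto

text \<open>If some \<open>E\<close> fails where its \<open>H\<close> holds, the pair and one of its
  members are 0 while the other member is at most 1. In all other cases equality holds.\<close>

lemma pair_conjunction_ge:
  assumes "x {i} \<le> 1" "x {j} \<le> 1" "x {i, j} = x {i} + x {j} - 1"
  shows "conjunction E H x {i, j} w \<ge> conjunction E H x {i} w + conjunction E H x {j} w - 1"
  using assms unfolding conjunction_def Collect_mem_insert by auto

text \<open>Some \<open>H\<close> holds at \<open>w\<close>, so the set of failing \<open>H\<close>
  is a proper subset and the value \<open>x {i, j, k}\<close> does not occur.\<close>

lemma triple_conjunction_nonneg:
  assumes "\<And>S. S \<noteq> {} \<Longrightarrow> S \<subset> {i, j, k} \<Longrightarrow> x S \<ge> 0"
    and "w \<in> conditioning_event H {i, j, k}"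
  shows "conjunction E H x {i, j, k} w \<ge> 0"
proof (cases "w \<in> (\<Inter>l\<in>{i, j, k}. E l \<inter> H l) \<or> w \<in> (\<Union>l\<in>{i, j, k}. - E l \<inter> H l)")
  case False
  then have "{l \<in> {i, j, k}. w \<notin> H l} \<noteq> {}" by blast
  moreover have "{l \<in> {i, j, k}. w \<notin> H l} \<subset> {i, j, k}"
    using assms(2) unfolding conditioning_event_def by blast
  ultimately show ?thesis
    using False assms(1) unfolding conjunction_def by simp
qed (auto simp: conjunction_def)

text \<open>If \<open>\<C>\<^sub>i = 0\<close> with \<open>E\<^sub>i\<close> false and \<open>H\<^sub>i\<close> true, then the equality for \<open>\<C>\<^sub>i\<^sub>j\<close> forces \<open>\<C>\<^sub>j = 1\<close>, even
  where \<open>H\<^sub>j\<close> is false (there \<open>x\<^sub>j = 1\<close>).\<close>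
lemma triple_conjunction_eq:
  fixes E H x w
  defines "Y \<equiv> \<lambda>S. conjunction E H x S w"
  assumes "x {i, j} = x {i} + x {j} - 1" "x {i, k} = x {i} + x {k} - 1"
      "x {j, k} = x {j} + x {k} - 1"
    and "Y {i, j} = Y {i} + Y {j} - 1" "Y {i, k} = Y {i} + Y {k} - 1" "Y {j, k} = Y {j} + Y {k} - 1"
    and "w \<in> conditioning_event H {i, j, k}"
  shows "Y {i, j, k} = Y {i} + Y {j} + Y {k} - 2"
proof (cases "\<exists>l\<in>{i, j, k}. w \<in> H l \<and> w \<notin> E l")
  case True
  have zero: "Y S = 0" if "l \<in> S" "w \<in> H l" "w \<notin> E l" for l S
    using that unfolding Y_def conjunction_def by auto
  consider "w \<in> H i \<and> w \<notin> E i" | "w \<in> H j \<and> w \<notin> E j" | "w \<in> H k \<and> w \<notin> E k"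
    using True by blast
  then show ?thesis
  proof cases
    case 1
    then show ?thesis
      using zero[of i "{i}"] zero[of i "{i, j}"] zero[of i "{i, k}"] zero[of i "{i, j, k}"]
        assms(5,6) by simp
  next
    case 2
    then show ?thesis
      using zero[of j "{j}"] zero[of j "{i, j}"] zero[of j "{j, k}"] zero[of j "{i, j, k}"]
        assms(5,7) by simp
  next
    case 3
    then show ?thesis
      using zero[of k "{k}"] zero[of k "{i, k}"] zero[of k "{j, k}"] zero[of k "{i, j, k}"]
        assms(6,7) by simp
  qed
next
  case False
  then have Y: "Y S = (if \<forall>l\<in>S. w \<in> H l then 1 else x {l \<in> S. w \<notin> H l})" if "S \<subseteq> {i, j, k}" for S
    using that unfolding Y_def conjunction_def by auto
  \<comment> \<open>This excludes the value \<open>x {i, j, k}\<close>; the triple then equals 1, a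
    single \<open>x\<close> or a pair \<open>x\<close>, and additivity of the pair values gives the
    claim.\<close>
  have "w \<in> H i \<or> w \<in> H j \<or> w \<in> H k"
    using assms(8) unfolding conditioning_event_def by simp
  then show ?thesis
    using Y[of "{i}"] Y[of "{j}"] Y[of "{k}"] Y[of "{i, j, k}"] assms(2-4)
    unfolding Collect_mem_insert
    by (cases "w \<in> H i"; cases "w \<in> H j"; cases "w \<in> H k") simp_all
qed

section \<open>Necessity of the inequality and uniqueness of the extension\<close>

text \<open>Leaving \<open>\<F>\<close> open treats the families with and without the triple at
  once: the mean of the triple conjunction is determined by the smaller ones in either case.\<close>

lemma coherent_conjunctions_imp:
  assumes coh: "coherent_conjunctions E H x \<F>"
    and \<F>: "{{i}, {j}, {k}, {i, j}, {i, k}, {j, k}} \<subseteq> \<F>" "\<And>S. S \<in> \<F> \<Longrightarrow> S \<noteq> {} \<and> S \<subseteq> {i, j, k}"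
    and x: "x {i} \<in> {0..1}" "x {j} \<in> {0..1}" "x {k} \<in> {0..1}"
      "x {i, j} = x {i} + x {j} - 1" "x {i, k} = x {i} + x {k} - 1" "x {j, k} = x {j} + x {k} - 1"
    and nonneg: "\<And>S. S \<noteq> {} \<Longrightarrow> S \<subset> {i, j, k} \<Longrightarrow> x S \<ge> 0"
  shows "x {i} + x {j} + x {k} - 2 \<ge> 0"
    and "{i, j, k} \<in> \<F> \<Longrightarrow> x {i, j, k} = x {i} + x {j} + x {k} - 2"
proof -
  obtain A and p :: "'a set \<Rightarrow> real" and w where A: "finite A"
    and p: "\<And>C. C \<in> A \<Longrightarrow> p C \<ge> 0" "sum p A = 1"
    and w: "\<And>C. C \<in> A \<Longrightarrow> w C \<in> (\<Union>S\<in>\<F>. conditioning_event H S)"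
    and eq: "\<And>S. S \<in> \<F> \<Longrightarrow> (\<Sum>C\<in>A. p C *
        (if w C \<in> conditioning_event H S then conjunction E H x S (w C) else x S)) = x S"
    by (rule coherent_imp_mixture[OF coh[unfolded coherent_conjunctions_def]]) (rule that)
  define Y where "Y S C = conjunction E H x S (w C)" for S C
  have w': "w C \<in> conditioning_event H {i, j, k}" if "C \<in> A" for C
    using w[OF that] \<F>(2) unfolding conditioning_event_def by blast
  have mean: "(\<Sum>C\<in>A. p C * Y S C) = x S" if "S \<in> \<F>" for S
  proof -
    have "Y S C = (if w C \<in> conditioning_event H S then conjunction E H x S (w C) else x S)" for C
      unfolding Y_def using conjunction_outside \<F>(2)[OF that] by metis
    then show ?thesis
      using eq[OF that] by simp
  qed
  \<comment> \<open>The summands are nonnegative by the pair inequality and their sum is 0, so each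
    of them vanishes.\<close>
  have tight: "p C * (Y {l, m} C - Y {l} C - Y {m} C + 1) = 0"
    if "C \<in> A" "{{l}, {m}, {l, m}} \<subseteq> \<F>" "x {l} \<le> 1" "x {m} \<le> 1" "x {l, m} = x {l} + x {m} - 1"
    for l m C
  proof -
    have zero: "(\<Sum>C\<in>A. p C * (Y {l, m} C - Y {l} C - Y {m} C + 1)) = 0"
      using mean that p(2) by (simp add: algebra_simps sum.distrib sum_subtractf)
    have nn: "p C * (Y {l, m} C - Y {l} C - Y {m} C + 1) \<ge> 0" if "C \<in> A" for C
      using p(1)[OF that] pair_conjunction_ge[OF \<open>x {l} \<le> 1\<close> \<open>x {m} \<le> 1\<close>
          \<open>x {l, m} = x {l} + x {m} - 1\<close>, of E H "w C"]
      unfolding Y_def by (intro mult_nonneg_nonneg) auto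
    show ?thesis
      by (rule sum_nonneg_0[OF A _ zero \<open>C \<in> A\<close>]) (rule nn)
  qed
  have triple: "p C * Y {i, j, k} C = p C * (Y {i} C + Y {j} C + Y {k} C - 2)" if "C \<in> A" for C
  proof (cases "p C = 0")
    case False
    then have "Y {i, j} C = Y {i} C + Y {j} C - 1" "Y {i, k} C = Y {i} C + Y {k} C - 1"
      "Y {j, k} C = Y {j} C + Y {k} C - 1"
      using tight[OF that, of i j] tight[OF that, of i k] tight[OF that, of j k] \<F>(1) x by auto
    then show ?thesis
      unfolding Y_def by (simp only: triple_conjunction_eq[OF x(4-6) _ _ _ w'[OF that]])
  qed simp
  \<comment> \<open>The left side is a mean even if \<open>{i, j, k}\<close> is not in
    \<open>\<F>\<close>. Its nonnegativity yields the inequality; its identification with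
    \<open>x {i, j, k}\<close> yields uniqueness.\<close>
  have sum3: "(\<Sum>C\<in>A. p C * Y {i, j, k} C) = x {i} + x {j} + x {k} - 2"
  proof -
    have "(\<Sum>C\<in>A. p C * Y {i, j, k} C) = (\<Sum>C\<in>A. p C * (Y {i} C + Y {j} C + Y {k} C - 2))"
      using triple by (rule sum.cong[OF refl])
    also have "\<dots> = (\<Sum>C\<in>A. p C * Y {i} C) + (\<Sum>C\<in>A. p C * Y {j} C) + (\<Sum>C\<in>A. p C * Y {k} C)
        - 2 * sum p A"
      by (simp add: algebra_simps sum.distrib sum_subtractf sum_distrib_right)
    finally show ?thesis
      using mean \<F>(1) p(2) by simp
  qed
  have "Y {i, j, k} C \<ge> 0" if "C \<in> A" for C
    unfolding Y_def by (rule triple_conjunction_nonneg[OF nonneg w'[OF that]])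
  then have "(\<Sum>C\<in>A. p C * Y {i, j, k} C) \<ge> 0"
    using p(1) by (intro sum_nonneg mult_nonneg_nonneg)
  with sum3 show "x {i} + x {j} + x {k} - 2 \<ge> 0" by simp
  show "x {i, j, k} = x {i} + x {j} + x {k} - 2" if "{i, j, k} \<in> \<F>"
    using mean[OF that] sum3 by simp
qed

section \<open>Sufficiency: a mixture of four points\<close>

lemma logically_independent_point:
  assumes "logically_independent Fs"
  obtains w where "\<And>i. i < length Fs \<Longrightarrow> w \<in> Fs ! i \<longleftrightarrow> P i"
proof -
  define J where "J = {i. i < length Fs \<and> P i}"
  have "J \<subseteq> {..<length Fs}"
    unfolding J_def by auto
  then have "(\<Inter>i<length Fs. if i \<in> J then Fs ! i else - (Fs ! i)) \<noteq> {}"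
    using assms unfolding logically_independent_def by (elim allE impE)
  then obtain w where w: "w \<in> (\<Inter>i<length Fs. if i \<in> J then Fs ! i else - (Fs ! i))"
    unfolding ex_in_conv[symmetric] by (elim exE)
  have "w \<in> Fs ! i \<longleftrightarrow> P i" if "i < length Fs" for i
    using INT_D[OF w, of i] that by (cases "P i") (simp_all add: J_def)
  then show thesis by (rule that)
qed

text \<open>The formula for \<open>x S\<close> covers singletons, pairs and the triple uniformly: in
  the four-point mixture the conjunction over \<open>S\<close> is 0 exactly at the points
  \<open>w k\<close> with \<open>k\<close> in \<open>S\<close>, each of weight
  \<open>1 - x {k}\<close>.\<close>

lemma coherent_conjunctions_if:
  fixes x :: "nat set \<Rightarrow> real"
  assumes indep: "logically_independent [E 1, E 2, E 3, H 1, H 2, H 3]"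
    and \<F>: "\<F> \<subseteq> Pow {1, 2, 3} - {{}}" "\<F> \<noteq> {}"
    and le1: "x {1} \<le> 1" "x {2} \<le> 1" "x {3} \<le> 1"
    and ge: "x {1} + x {2} + x {3} - 2 \<ge> 0"
    and x: "\<And>S. S \<in> \<F> \<Longrightarrow> x S = 1 - (\<Sum>k\<in>S. 1 - x {k})"
  shows "coherent_conjunctions E H x \<F>"
proof -
  \<comment> \<open>The index \<open>k = 0\<close> gives the point where no \<open>E i\<close>
    fails.\<close>
  have "\<exists>w. \<forall>i\<in>{1, 2, 3}. w \<in> H i \<and> (w \<in> E i \<longleftrightarrow> i \<noteq> k)" if "k \<le> 3" for k
  proof -
    \<comment> \<open>List position \<open>i < 3\<close> holds \<open>E (Suc i)\<close>, hence the
      shift. The \<open>H\<close> occupy positions 3 to 5, where \<open>Suc i\<close> exceeds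
      \<open>k\<close>, so all of them hold.\<close>
    obtain w where "\<And>i. i < length [E 1, E 2, E 3, H 1, H 2, H 3] \<Longrightarrow>
        w \<in> [E 1, E 2, E 3, H 1, H 2, H 3] ! i \<longleftrightarrow> Suc i \<noteq> k"
      by (rule logically_independent_point[OF indep]) (rule that)
    from this[of 0] this[of 1] this[of 2] this[of 3] this[of 4] this[of 5] show ?thesis
      using that by (intro exI[of _ w]) auto
  qed
  then obtain w where w: "\<And>k i. k \<le> 3 \<Longrightarrow> i \<in> {1, 2, 3} \<Longrightarrow> w k \<in> H i \<and> (w k \<in> E i \<longleftrightarrow> i \<noteq> k)"
    by metis
  define p where "p k = (if k = 0 then x {1} + x {2} + x {3} - 2 else 1 - x {k})" for k
  define J :: "nat set" where "J = {0, 1, 2, 3}"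
  have p1: "sum p J = 1"
    unfolding J_def p_def by simp
  have val: "conjunction E H x S (w k) = (if k \<in> S then 0 else 1)" if "S \<in> \<F>" "k \<in> J" for S k
  proof -
    have "S \<subseteq> {1, 2, 3}" "k \<le> 3"
      using that \<F>(1) unfolding J_def by auto
    then have "w k \<in> H i \<and> (w k \<in> E i \<longleftrightarrow> i \<noteq> k)" if "i \<in> S" for i
      using w that by blast
    then show ?thesis
      unfolding conjunction_def by auto
  qed
  show ?thesis
    unfolding coherent_conjunctions_def
  proof (rule coherent_if_mixture[where J = J and p = p and w = w])
    show "finite \<F>"
      using \<F>(1) by (rule finite_subset) simp
    show "finite (conjunction E H x S ` conditioning_event H S)" if "S \<in> \<F>" for S
      using that \<F>(1) by (intro finite_conjunction_image) (auto intro: finite_subset)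
    show "p j \<ge> 0" if "j \<in> J" for j
      using that le1 ge unfolding J_def p_def by auto
    show "w j \<in> conditioning_event H S" if "S \<in> \<F>" "j \<in> J" for S j
    proof -
      obtain i where "i \<in> S" "i \<in> {1, 2, 3}"
        using \<open>S \<in> \<F>\<close> \<F>(1) by blast
      moreover have "j \<le> 3"
        using that(2) unfolding J_def by auto
      ultimately show ?thesis
        using w unfolding conditioning_event_def by blast
    qed
    show "(\<Sum>j\<in>J. p j * conjunction E H x S (w j)) = x S" if "S \<in> \<F>" for S
    proof -
      have S: "S \<subseteq> {1, 2, 3}" and "S \<subseteq> J"
        using that \<F>(1) unfolding J_def by auto
      \<comment> \<open>The conjunction is the indicator of \<open>J - S\<close> on the indices, so
        its mean is the weight outside \<open>S\<close>.\<close>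
      have "(\<Sum>j\<in>J. p j * conjunction E H x S (w j)) = sum p (J - S)"
        using val[OF that] by (intro sum.mono_neutral_cong_right) (auto simp: J_def)
      also have "\<dots> = 1 - sum p S"
        using p1 \<open>S \<subseteq> J\<close> by (simp add: sum_diff J_def)
      also have "sum p S = (\<Sum>k\<in>S. 1 - x {k})"
        using S by (intro sum.cong) (auto simp: p_def)
      finally show ?thesis
        using x[OF that] by simp
    qed
  qed (use \<F>(2) J_def p1 in auto)
qed

theorem theorem10:
  fixes E H :: "nat \<Rightarrow> 'w set" and x :: "nat set \<Rightarrow> real"
  assumes "logically_independent [E 1, E 2, E 3, H 1, H 2, H 3]"
    and "x {1} \<in> {0..1}" "x {2} \<in> {0..1}" "x {3} \<in> {0..1}"
    and "T_L (x {1}) (x {2}) > 0" "T_L (x {1}) (x {3}) > 0" "T_L (x {2}) (x {3}) > 0"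
    and "x {1, 2} = T_L (x {1}) (x {2})"
    and "x {1, 3} = T_L (x {1}) (x {3})"
    and "x {2, 3} = T_L (x {2}) (x {3})"
  shows "(coherent_conjunctions E H x {{1}, {2}, {3}, {1, 2}, {1, 3}, {2, 3}} \<longleftrightarrow>
            x {1} + x {2} + x {3} - 2 \<ge> 0) \<and>
         (x {1} + x {2} + x {3} - 2 \<ge> 0 \<longrightarrow>
            (\<forall>x123. coherent_conjunctions E H (x({1, 2, 3} := x123))
                       {{1}, {2}, {3}, {1, 2}, {1, 3}, {2, 3}, {1, 2, 3}} \<longleftrightarrow>
                     x123 = T_L3 (x {1}) (x {2}) (x {3})))"
proof -
  let ?F = "{{1}, {2}, {3}, {1, 2}, {1, 3}, {2, 3}} :: nat set set"
  let ?G = "{{1}, {2}, {3}, {1, 2}, {1, 3}, {2, 3}, {1, 2, 3}} :: nat set set"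
  have x: "x {1, 2} = x {1} + x {2} - 1" "x {1, 3} = x {1} + x {3} - 1"
    "x {2, 3} = x {2} + x {3} - 1"
    \<comment> \<open>Positivity of the three t-norm values removes the maximum with 0.\<close>
    using assms(5-10) unfolding T_L_def by auto
  have pos: "x {1, 2} > 0" "x {1, 3} > 0" "x {2, 3} > 0"
    using assms(5-10) by auto
  have proper: "S \<in> ?F" if "S \<noteq> {}" "S \<subset> {1, 2, 3}" for S
  proof -
    have "S \<in> Pow {1, 2, 3}" using that by blast
    then show ?thesis using that by (auto simp: Pow_insert)
  qed
  have nonneg: "x S \<ge> 0" if "S \<noteq> {}" "S \<subset> {1, 2, 3}" for S
    using proper[OF that] pos assms(2-4) by auto
  \<comment> \<open>Cardinality separates the six smaller index sets from \<open>{1, 2, 3}\<close>,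
    so changing the triple value leaves theirs intact.\<close>
  have upd: "(x({1, 2, 3} := t)) S = x S" if "S \<in> ?F" for S t
  proof -
    have "card S \<le> 2"
      using that by (elim insertE emptyE) simp_all
    then have "S \<noteq> {1, 2, 3}" by auto
    then show ?thesis by simp
  qed
  \<comment> \<open>The inner maximum disappears because \<open>x {1, 2}\<close> is positive, the
    outer one by the assumed inequality.\<close>
  have T3: "T_L3 (x {1}) (x {2}) (x {3}) = x {1} + x {2} + x {3} - 2"
    if "x {1} + x {2} + x {3} - 2 \<ge> 0"
    using that x(1) pos(1) unfolding T_L3_def T_L_def by auto
  have 1: "x {1} + x {2} + x {3} - 2 \<ge> 0" if "coherent_conjunctions E H x ?F"
    by (rule coherent_conjunctions_imp(1)[OF that]) (use assms(2-4) x nonneg in auto)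
  have 2: "coherent_conjunctions E H x ?F" if "x {1} + x {2} + x {3} - 2 \<ge> 0"
    by (rule coherent_conjunctions_if[OF assms(1)]) (use assms(2-4) x that in auto)
  have 3: "t = x {1} + x {2} + x {3} - 2"
    if coh: "coherent_conjunctions E H (x({1, 2, 3} := t)) ?G" for t
  proof -
    define y where "y = x({1, 2, 3} := t)"
    have y: "y {1} = x {1}" "y {2} = x {2}" "y {3} = x {3}"
      "y {1, 2} = x {1, 2}" "y {1, 3} = x {1, 3}" "y {2, 3} = x {2, 3}"
      unfolding y_def by (rule upd, blast)+
    have "y {1, 2, 3} = y {1} + y {2} + y {3} - 2"
    proof (rule coherent_conjunctions_imp(2)[OF coh[folded y_def]])
      show "y S \<ge> 0" if "S \<noteq> {}" "S \<subset> {1, 2, 3}" for S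
        unfolding y_def using nonneg[OF that] upd[OF proper[OF that]] by metis
    qed (use assms(2-4) x y in auto)
    moreover have "y {1, 2, 3} = t"
      unfolding y_def by simp
    ultimately show ?thesis
      using y by simp
  qed
  have 4: "coherent_conjunctions E H (x({1, 2, 3} := x {1} + x {2} + x {3} - 2)) ?G"
    if ge: "x {1} + x {2} + x {3} - 2 \<ge> 0"
  proof -
    define y where "y = x({1, 2, 3} := x {1} + x {2} + x {3} - 2)"
    have y: "y {1} = x {1}" "y {2} = x {2}" "y {3} = x {3}"
      "y {1, 2} = x {1, 2}" "y {1, 3} = x {1, 3}" "y {2, 3} = x {2, 3}"
      unfolding y_def by (rule upd, blast)+
    have y123: "y {1, 2, 3} = x {1} + x {2} + x {3} - 2"
      unfolding y_def by simp
    have "coherent_conjunctions E H y ?G"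
    proof (rule coherent_conjunctions_if[OF assms(1)])
      show "y S = 1 - (\<Sum>k\<in>S. 1 - y {k})" if "S \<in> ?G" for S
        using that x y y123 by (elim insertE emptyE) simp_all
    qed (use assms(2-4) ge y in auto)
    then show ?thesis
      unfolding y_def .
  qed
  show ?thesis
    using 1 2 3 4 T3 by metis
qed

end
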